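(* A Banach space $X$ has the Schur property if and only if every reflexive cone of $X$ with a bounded base defined by a vector of $X^*$ is strongly reflexive.
   Context: All spaces are real. $B_X$ is the closed unit ball of $X$. A cone of $X$ is a nonempty convex set $P\subseteq X$ with $\lambda P\subseteq P$ for every real $\lambda\ge 0$. A cone $P$ of a Banach space $X$ is reflexive if $P\cap B_X$ is weakly compact, and strongly reflexive if $P\cap B_X$ is norm compact. A functional $x^*\in X^*$ is strictly positive on $P$ if $x^*(x)>0$ for each $x\in P\setminus\{0\}$; in that case the base for $P$ defined by $x^*$ is $B_{x^*}=\{x\in P: x^*(x)=1\}$. Thus $P$ has a bounded base defined by a vector of $X^*$ if there is $x^*\in X^*$ strictly positive on $P$ with $B_{x^*}$ bounded. $X$ has the Schur property if every weakly convergent sequence of $X$ is norm convergent. *)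

theory Defs
  imports "HOL-Analysis.Analysis"
begin

text \<open>The weak topology is the coarsest topology making every functional in the dual
  \<open>'a \<Rightarrow>\<^sub>L real\<close> continuous. It is stated as the pullback, under the evaluation map
  \<open>x \<mapsto> (f \<mapsto> f x)\<close>, of the product topology, which is what \<open>euclidean\<close> denotes
  on the function type \<open>('a \<Rightarrow>\<^sub>L real) \<Rightarrow> real\<close>; compare \<open>strong_operator_topology\<close>.\<close>

definition weak_topology :: "'a::real_normed_vector topology" where
  "weak_topology =
     pullback_topology UNIV (\<lambda>x (f :: 'a \<Rightarrow>\<^sub>L real). blinfun_apply f x) euclidean"

lemma topspace_weak_topology [simp]: "topspace weak_topology = UNIV"
  by (simp add: weak_topology_def topspace_pullback_topology)

lemma continuous_map_weak_topology_blinfun: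
  fixes f :: "'a::real_normed_vector \<Rightarrow>\<^sub>L real"
  shows "continuous_map weak_topology euclidean (blinfun_apply f)"
proof -
  have "continuous_map weak_topology euclidean
          ((\<lambda>h. h f) \<circ> (\<lambda>x (g :: 'a \<Rightarrow>\<^sub>L real). blinfun_apply g x))"
    unfolding weak_topology_def
    by (rule continuous_map_pullback) (auto intro: continuous_on_product_coordinates)
  then show ?thesis by (simp add: comp_def)
qed

lemma continuous_map_into_weak_topology:
  fixes T :: "'b topology" and h :: "'b \<Rightarrow> 'a::real_normed_vector"
  assumes "\<And>f :: 'a \<Rightarrow>\<^sub>L real. continuous_map T euclidean (\<lambda>t. blinfun_apply f (h t))"
  shows "continuous_map T weak_topology h"
  unfolding weak_topology_def
proof (rule continuous_map_pullback')
  show "continuous_map T euclidean ((\<lambda>x (f :: 'a \<Rightarrow>\<^sub>L real). blinfun_apply f x) \<circ> h)"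
    unfolding comp_def euclidean_product_topology[symmetric]
    by (rule continuous_map_coordinatewise_then_product) (use assms in auto)
qed auto

definition schur_property :: "'a::banach itself \<Rightarrow> bool" where
  "schur_property (_ :: 'a itself) \<longleftrightarrow>
     (\<forall>(x :: nat \<Rightarrow> 'a) l. limitin weak_topology x l sequentially \<longrightarrow> convergent x)"

definition reflexive_cone :: "'a::banach set \<Rightarrow> bool" where
  "reflexive_cone P \<longleftrightarrow> convex_cone P \<and> compactin weak_topology (P \<inter> cball 0 1)"

definition strongly_reflexive_cone :: "'a::banach set \<Rightarrow> bool" where
  "strongly_reflexive_cone P \<longleftrightarrow> convex_cone P \<and> compact (P \<inter> cball 0 1)"

definition strictly_positive_on :: "('a::real_normed_vector \<Rightarrow>\<^sub>L real) \<Rightarrow> 'a set \<Rightarrow> bool" where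
  "strictly_positive_on f P \<longleftrightarrow> (\<forall>x \<in> P - {0}. blinfun_apply f x > 0)"

definition cone_base :: "('a::real_normed_vector \<Rightarrow>\<^sub>L real) \<Rightarrow> 'a set \<Rightarrow> 'a set" where
  "cone_base f P = {x \<in> P. blinfun_apply f x = 1}"

definition has_bounded_base :: "'a::real_normed_vector set \<Rightarrow> bool" where
  "has_bounded_base P \<longleftrightarrow>
     (\<exists>f :: 'a \<Rightarrow>\<^sub>L real. strictly_positive_on f P \<and> bounded (cone_base f P))"

end

theory Submission
  imports Defs
begin

text \<open>
  If \<open>X\<close> has the Schur property, then every weakly compact set of \<open>X\<close> is norm compact, in particular
  the part of a reflexive cone in the unit ball. Indeed a sequence in a weakly compact set
  has a weakly convergent subsequence (\<open>weakly_compact_imp_weakly_seq_compact\<close>, one half of the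
  Eberlein-Smulian theorem), and the Schur property makes this subsequence converge in norm.

  If \<open>X\<close> does not have the Schur property, then there is a weakly null sequence \<open>z\<close> of unit vectors.
  For a vector \<open>x0\<close>, the points \<open>t x0 + (\<Sum>k. a k z k)\<close> with \<open>a k \<ge> 0\<close> and
  \<open>(\<Sum>k. a k) \<le> t\<close> form a cone. The coefficients with \<open>t \<le> T\<close> are a compact subset of a product of
  intervals. Because \<open>z\<close> is weakly null, the point depends continuously on them for the weak
  topology, so the cone is reflexive. A functional that is positive at \<open>x0\<close> is close to zero on
  the tail of \<open>z\<close>, so it controls \<open>t\<close> after finitely many terms have been dropped; this gives the
  bounded base. The cone contains the points \<open>x0 + z k\<close>, which have no norm convergent subsequence,
  so it is not strongly reflexive (\<open>cone_from_weakly_null_sequence\<close>).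

  Both directions need enough functionals: to separate points, to see that balls and closed
  subspaces are weakly closed, and to find the functional that defines the base. They come from the
  Hahn-Banach theorem, proved here by the observation that a minimal sublinear functional is linear.
\<close>

section \<open>The Hahn-Banach theorem\<close>

definition sublinear :: "('a::real_vector \<Rightarrow> real) \<Rightarrow> bool" where
  "sublinear p \<longleftrightarrow> (\<forall>x y. p (x + y) \<le> p x + p y) \<and> (\<forall>c x. 0 \<le> c \<longrightarrow> p (c *\<^sub>R x) = c * p x)"

text \<open>Homogeneity follows from its upper half: apply that half to \<open>c\<close> and to \<open>inverse c\<close>.\<close>

lemma sublinearI:
  assumes add: "\<And>x y. p (x + y) \<le> p x + p y"
    and zero: "p 0 \<le> 0"
    and scale: "\<And>c x. 0 < c \<Longrightarrow> p (c *\<^sub>R x) \<le> c * p x"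
  shows "sublinear p"
  unfolding sublinear_def
proof (intro conjI allI impI)
  fix c :: real and x :: 'a
  assume "0 \<le> c"
  show "p (c *\<^sub>R x) = c * p x"
  proof (cases "c = 0")
    case True
    then show ?thesis using add[of 0 0] zero by simp
  next
    case False
    then have "0 < c" using \<open>0 \<le> c\<close> by simp
    then have "p (inverse c *\<^sub>R (c *\<^sub>R x)) \<le> inverse c * p (c *\<^sub>R x)"
      by (intro scale) simp
    then have "c * p x \<le> p (c *\<^sub>R x)"
      using \<open>0 < c\<close> by (simp add: field_simps)
    with scale[OF \<open>0 < c\<close>, of x] show ?thesis by simp
  qed
qed (rule add)

lemma sublinear_add: "sublinear p \<Longrightarrow> p (x + y) \<le> p x + p y"
  by (simp add: sublinear_def)

lemma sublinear_scaleR: "sublinear p \<Longrightarrow> 0 \<le> c \<Longrightarrow> p (c *\<^sub>R x) = c * p x"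
  by (simp add: sublinear_def)

lemma sublinear_0: "sublinear p \<Longrightarrow> p 0 = 0"
  using sublinear_scaleR[of p 0 0] by simp

lemma sublinear_ge_minus: "sublinear p \<Longrightarrow> - p (- x) \<le> p x"
  using sublinear_add[of p x "- x"] by (simp add: sublinear_0)

text \<open>This gives the subadditivity of each of the infima below: the infimum at \<open>x + y\<close> is at most
  the sum of any competitor at \<open>x\<close> and any competitor at \<open>y\<close>.\<close>

lemma le_add_cINF:
  fixes f :: "'i \<Rightarrow> real" and g :: "'j \<Rightarrow> real"
  assumes "A \<noteq> {}" "B \<noteq> {}" "\<And>a b. a \<in> A \<Longrightarrow> b \<in> B \<Longrightarrow> c \<le> f a + g b"
  shows "c \<le> (INF a\<in>A. f a) + (INF b\<in>B. g b)"
proof -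
  have "c - g b \<le> (INF a\<in>A. f a)" if "b \<in> B" for b
    using assms that by (intro cINF_greatest) (auto simp: algebra_simps)
  then have "c - (INF a\<in>A. f a) \<le> (INF b\<in>B. g b)"
    using assms(2) by (intro cINF_greatest) (auto simp: algebra_simps)
  then show ?thesis by simp
qed

text \<open>The functional \<open>q\<close> is the infimum of the tilted functionals \<open>x \<mapsto> p (x + t v) - t p v\<close>
  over \<open>t \<ge> 0\<close>: \<open>t = 0\<close> gives \<open>q \<le> p\<close> and \<open>t = 1\<close> gives the bound at \<open>- v\<close>. The infimum is
  finite because \<open>t p v = p (t v) \<le> p (x + t v) + p (- x)\<close>. The lemma has two uses: it
  shows that a minimal sublinear functional is odd, and it makes the functional obtained from
  minimality agree with \<open>p\<close> at a prescribed point.\<close>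

lemma sublinear_tilt:
  fixes p :: "'a::real_vector \<Rightarrow> real"
  assumes p: "sublinear p"
  obtains q where "sublinear q" "q \<le> p" "q (- v) \<le> - p v"
proof
  define q where "q x = (INF t\<in>{0..}. p (x + t *\<^sub>R v) - t * p v)" for x
  have below: "- p (- x) \<le> p (x + t *\<^sub>R v) - t * p v" if "0 \<le> t" for x t
    using sublinear_add[OF p, of "x + t *\<^sub>R v" "- x"] sublinear_scaleR[OF p that, of v] by simp
  have lower: "q x \<le> p (x + t *\<^sub>R v) - t * p v" if "0 \<le> t" for x t
    unfolding q_def using that below
    by (intro cINF_lower bdd_belowI2[where m = "- p (- x)"]) auto
  have greatest: "c \<le> q x" if "\<And>t. 0 \<le> t \<Longrightarrow> c \<le> p (x + t *\<^sub>R v) - t * p v" for c x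
    unfolding q_def using that by (intro cINF_greatest) auto
  show "sublinear q"
  proof (rule sublinearI)
    fix x y
    have "q (x + y) \<le> (p (x + s *\<^sub>R v) - s * p v) + (p (y + t *\<^sub>R v) - t * p v)"
      if "0 \<le> s" "0 \<le> t" for s t
      using lower[of "s + t" "x + y"] that sublinear_add[OF p, of "x + s *\<^sub>R v" "y + t *\<^sub>R v"]
      by (simp add: algebra_simps)
    then show "q (x + y) \<le> q x + q y"
      unfolding q_def[of x] q_def[of y] by (intro le_add_cINF) auto
  next
    show "q 0 \<le> 0" using lower[of 0 0] by (simp add: sublinear_0[OF p])
  next
    fix c :: real and x :: 'a
    assume c: "0 < c"
    have "q (c *\<^sub>R x) / c \<le> p (x + t *\<^sub>R v) - t * p v" if "0 \<le> t" for t
      using lower[of "c * t" "c *\<^sub>R x"] c that sublinear_scaleR[OF p, of c "x + t *\<^sub>R v"]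
      by (simp add: field_simps scaleR_add_right)
    from greatest[OF this] show "q (c *\<^sub>R x) \<le> c * q x" using c by (simp add: field_simps)
  qed
  show "q \<le> p" using lower[of 0] by (simp add: le_fun_def)
  show "q (- v) \<le> - p v" using lower[of 1 "- v"] by (simp add: sublinear_0[OF p])
qed

text \<open>By Zorn's lemma there is a minimal sublinear functional below \<open>p\<close>; chains have their
  pointwise infimum as a lower bound. Tilting a minimal \<open>f\<close> at \<open>v\<close> cannot make it smaller,
  so \<open>f (- v) \<le> - f v\<close>. An odd sublinear functional is linear.\<close>

lemma linear_below_sublinear:
  fixes p :: "'a::real_vector \<Rightarrow> real"
  assumes p: "sublinear p"
  obtains f where "linear f" "f \<le> p"
proof -
  define A where "A = {q. sublinear q \<and> q \<le> p}"
  have "\<exists>m\<in>A. \<forall>a\<in>A. a \<le> m \<longrightarrow> a = m"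
  proof (rule predicate_Zorn)
    show "partial_order_on A (relation_of (\<lambda>a b. b \<le> a) A)"
      by (rule partial_order_on_relation_ofI) auto
  next
    fix C
    assume "C \<in> Chains (relation_of (\<lambda>a b. b \<le> a) A)"
    then have chain: "a \<in> A" "a \<le> b \<or> b \<le> a" if "a \<in> C" "b \<in> C" for a b
      using that by (auto simp: Chains_def relation_of_def)
    have CA: "C \<subseteq> A" using chain(1) by blast
    show "\<exists>u\<in>A. \<forall>a\<in>C. u \<le> a"
    proof (cases "C = {}")
      case True
      then show ?thesis using p by (auto simp: A_def)
    next
      case False
      define u where "u x = (INF q\<in>C. q x)" for x
      have sub: "sublinear q" "q x \<le> p x" if "q \<in> C" for q x
        using that CA by (auto simp: A_def le_fun_def)
      have "- p (- x) \<le> q x" if "q \<in> C" for q x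
        using sublinear_ge_minus[OF sub(1)[OF that], of x] sub(2)[OF that, of "- x"] by simp
      then have lower: "u x \<le> q x" if "q \<in> C" for q x
        unfolding u_def using that by (intro cINF_lower bdd_belowI2[where m = "- p (- x)"]) auto
      have "sublinear u"
      proof (rule sublinearI)
        fix x y
        have "u (x + y) \<le> q x + r y" if "q \<in> C" "r \<in> C" for q r
        proof -
          obtain m where m: "m \<in> C" "m \<le> q" "m \<le> r"
            using chain(2)[OF \<open>q \<in> C\<close> \<open>r \<in> C\<close>] \<open>q \<in> C\<close> \<open>r \<in> C\<close> by (meson order_refl)
          then have "u (x + y) \<le> m x + m y"
            using lower[OF m(1)] sublinear_add[OF sub(1)[OF m(1)]] by (meson order_trans)
          then show ?thesis using le_funD[OF m(2), of x] le_funD[OF m(3), of y] by simp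
        qed
        then show "u (x + y) \<le> u x + u y"
          unfolding u_def[of x] u_def[of y] using False by (intro le_add_cINF) auto
      next
        obtain q where "q \<in> C" using False by blast
        then show "u 0 \<le> 0" using lower[of q 0] sublinear_0[OF sub(1)[of q]] by simp
      next
        fix c :: real and x :: 'a
        assume c: "0 < c"
        have "u (c *\<^sub>R x) / c \<le> q x" if "q \<in> C" for q
          using lower[OF that, of "c *\<^sub>R x"] sublinear_scaleR[OF sub(1)[OF that], of c x] c
          by (simp add: field_simps)
        then have "u (c *\<^sub>R x) / c \<le> u x"
          unfolding u_def[of x] using False by (intro cINF_greatest) auto
        then show "u (c *\<^sub>R x) \<le> c * u x" using c by (simp add: field_simps)
      qed
      moreover have "u \<le> p"
      proof -
        obtain q where "q \<in> C" using False by blast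
        then show ?thesis using lower sub(2) by (meson le_funI order_trans)
      qed
      ultimately show ?thesis using lower by (auto simp: A_def le_fun_def)
    qed
  qed
  then obtain f where f: "sublinear f" "f \<le> p"
    and min: "\<And>q. sublinear q \<Longrightarrow> q \<le> f \<Longrightarrow> q = f"
    unfolding A_def by (smt (verit, best) mem_Collect_eq order_trans)
  have minus: "f (- v) = - f v" for v
  proof -
    obtain q where "sublinear q" "q \<le> f" "q (- v) \<le> - f v"
      by (rule sublinear_tilt[OF f(1)])
    then show ?thesis using min sublinear_ge_minus[OF f(1), of v] by fastforce
  qed
  have "linear f"
  proof (rule linearI)
    fix x y
    show "f (x + y) = f x + f y"
      using sublinear_add[OF f(1), of x y] sublinear_add[OF f(1), of "- x" "- y"] minus[of x] minus[of y]
        minus[of "x + y"] by simp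
  next
    fix c x
    show "f (c *\<^sub>R x) = c *\<^sub>R f x"
      using sublinear_scaleR[OF f(1), of c x] sublinear_scaleR[OF f(1), of "- c" x]
        minus[of "c *\<^sub>R x"] by (cases "0 \<le> c") auto
  qed
  then show ?thesis using that f(2) by blast
qed

text \<open>Tilting \<open>p\<close> at \<open>v\<close> before a linear functional \<open>f\<close> is chosen forces
  \<open>f (- v) \<le> - p v\<close>, that is, \<open>p v \<le> f v\<close>.\<close>

theorem hahn_banach_sublinear:
  fixes p :: "'a::real_vector \<Rightarrow> real"
  assumes p: "sublinear p"
  obtains f where "linear f" "\<And>x. f x \<le> p x" "f v = p v"
proof -
  obtain q where q: "sublinear q" "q \<le> p" "q (- v) \<le> - p v"
    by (rule sublinear_tilt[OF p])
  obtain f where f: "linear f" "f \<le> q"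
    by (rule linear_below_sublinear[OF q(1)])
  have le: "f x \<le> p x" for x using f(2) q(2) by (auto simp: le_fun_def intro: order_trans)
  moreover have "f (- v) \<le> - p v" using f(2) q(3) by (auto simp: le_fun_def intro: order_trans)
  then have "p v \<le> f v" using f(1) by (simp add: linear_neg)
  ultimately show ?thesis using that f(1) by (meson order_antisym)
qed

lemma sublinear_infdist_subspace:
  fixes Y :: "'a::real_normed_vector set"
  assumes Y: "subspace Y"
  shows "sublinear (\<lambda>x. infdist x Y)"
proof -
  have ne: "Y \<noteq> {}" using Y subspace_0 by blast
  show ?thesis
  proof (rule sublinearI)
    fix x y
    have "infdist (x + y) Y \<le> dist x a + dist y b" if "a \<in> Y" "b \<in> Y" for a b
      using infdist_le[OF subspace_add[OF Y that], of "x + y"] dist_triangle_add[of x y a b] by simp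
    then show "infdist (x + y) Y \<le> infdist x Y + infdist y Y"
      unfolding infdist_notempty[OF ne, of x] infdist_notempty[OF ne, of y]
      using ne by (intro le_add_cINF) auto
  next
    show "infdist 0 Y \<le> 0" using infdist_le[OF subspace_0[OF Y], of 0] by simp
  next
    fix c :: real and x :: 'a
    assume c: "0 < c"
    have "infdist (c *\<^sub>R x) Y / c \<le> dist x a" if "a \<in> Y" for a
    proof -
      have "dist (c *\<^sub>R x) (c *\<^sub>R a) = c * dist x a"
        using c by (simp add: dist_norm flip: scaleR_diff_right)
      then show ?thesis
        using infdist_le[OF subspace_scale[OF Y that, of c], of "c *\<^sub>R x"] c
        by (simp add: field_simps)
    qed
    then have "infdist (c *\<^sub>R x) Y / c \<le> infdist x Y"
      unfolding infdist_notempty[OF ne, of x] using ne by (intro cINF_greatest)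
    then show "infdist (c *\<^sub>R x) Y \<le> c * infdist x Y" using c by (simp add: field_simps)
  qed
qed

text \<open>The distance to a subspace is sublinear, is at most the norm, and vanishes on the subspace.
  One functional therefore serves two purposes: for closed \<open>Y\<close> it separates a point from \<open>Y\<close>,
  and for \<open>Y = {0}\<close> it norms a point.\<close>

corollary hahn_banach_infdist:
  fixes Y :: "'a::real_normed_vector set"
  assumes Y: "subspace Y"
  obtains g :: "'a \<Rightarrow>\<^sub>L real"
  where "\<And>x. \<bar>blinfun_apply g x\<bar> \<le> norm x" "\<And>y. y \<in> Y \<Longrightarrow> blinfun_apply g y = 0"
    "blinfun_apply g v = infdist v Y"
proof -
  obtain f where f: "linear f" "\<And>x. f x \<le> infdist x Y" "f v = infdist v Y"
    by (rule hahn_banach_sublinear[OF sublinear_infdist_subspace[OF Y]]) blast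
  have "f x \<le> norm x" for x
    using f(2)[of x] infdist_le[OF subspace_0[OF Y], of x] by simp
  then have bound: "\<bar>f x\<bar> \<le> norm x" for x
    using linear_neg[OF f(1), of x] by (metis abs_leI norm_minus_cancel)
  have "f y = 0" if "y \<in> Y" for y
    using f(2)[of y] f(2)[of "- y"] that subspace_neg[OF Y that] linear_neg[OF f(1), of y]
    by simp
  moreover have "bounded_linear f"
    using f(1) bound
    by (intro bounded_linear_intro[where K = 1]) (auto simp: linear_add linear_scale)
  ultimately show ?thesis
    using that[of "Blinfun f"] bound f(3) by (simp add: bounded_linear_Blinfun_apply)
qed

corollary norming_functional:
  fixes v :: "'a::real_normed_vector"
  obtains g :: "'a \<Rightarrow>\<^sub>L real"
  where "\<And>x. \<bar>blinfun_apply g x\<bar> \<le> norm x" "blinfun_apply g v = norm v"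
  by (rule hahn_banach_infdist[OF subspace_single_0, of v]) auto

section \<open>Weakly closed sets\<close>

lemma limitin_weak_imp_tendsto:
  fixes g :: "'a::real_normed_vector \<Rightarrow>\<^sub>L real"
  assumes "limitin weak_topology x l F"
  shows "((\<lambda>n. blinfun_apply g (x n)) \<longlongrightarrow> blinfun_apply g l) F"
  using continuous_map_limit[OF continuous_map_weak_topology_blinfun[of g] assms]
  by (simp add: o_def)

lemma functionals_separate_points:
  fixes x y :: "'a::real_normed_vector"
  assumes "\<And>g :: 'a \<Rightarrow>\<^sub>L real. blinfun_apply g x = blinfun_apply g y"
  shows "x = y"
proof -
  obtain g :: "'a \<Rightarrow>\<^sub>L real" where "blinfun_apply g (x - y) = norm (x - y)"
    by (rule norming_functional)
  then show ?thesis using assms[of g] by (simp add: blinfun.diff_right)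
qed

lemma closedin_weak_vimage:
  fixes g :: "'a::real_normed_vector \<Rightarrow>\<^sub>L real"
  assumes "closed C"
  shows "closedin weak_topology {x. blinfun_apply g x \<in> C}"
  using closedin_continuous_map_preimage[OF continuous_map_weak_topology_blinfun[of g], of C] assms
  by simp

text \<open>The ball is the intersection of the half-spaces given by the functionals of norm at
  most one.\<close>

lemma closedin_weak_cball:
  "closedin weak_topology (cball (0::'a::real_normed_vector) r)"
proof -
  define G :: "('a \<Rightarrow>\<^sub>L real) set" where "G = {g. \<forall>x. \<bar>blinfun_apply g x\<bar> \<le> norm x}"
  have "cball 0 r = (\<Inter>g\<in>G. {x. blinfun_apply g x \<in> {..r}})"
  proof (intro equalityI subsetI)
    fix x :: 'a
    assume "x \<in> cball 0 r"
    then show "x \<in> (\<Inter>g\<in>G. {x. blinfun_apply g x \<in> {..r}})"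
      by (auto simp: G_def intro: order_trans[OF abs_ge_self] order_trans)
  next
    fix x :: 'a
    assume x: "x \<in> (\<Inter>g\<in>G. {x. blinfun_apply g x \<in> {..r}})"
    obtain g :: "'a \<Rightarrow>\<^sub>L real" where "\<And>x. \<bar>blinfun_apply g x\<bar> \<le> norm x" "blinfun_apply g x = norm x"
      by (rule norming_functional[of x]) blast
    then show "x \<in> cball 0 r" using x by (fastforce simp: G_def)
  qed
  moreover have "closedin weak_topology (\<Inter>g\<in>G. {x. blinfun_apply g x \<in> {..r}})"
  proof (intro closedin_INT closedin_weak_vimage)
    have "0 \<in> G" by (simp add: G_def)
    then show "G \<noteq> {}" by blast
  qed auto
  ultimately show ?thesis by simp
qed

text \<open>A closed subspace is the common kernel of the functionals that vanish on it.\<close>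

lemma closedin_weak_subspace:
  fixes Y :: "'a::real_normed_vector set"
  assumes Y: "subspace Y" "closed Y"
  shows "closedin weak_topology Y"
proof -
  define G :: "('a \<Rightarrow>\<^sub>L real) set" where "G = {g. \<forall>y\<in>Y. blinfun_apply g y = 0}"
  have "Y = (\<Inter>g\<in>G. {x. blinfun_apply g x \<in> {0}})"
  proof (intro equalityI subsetI)
    fix x :: 'a
    assume x: "x \<in> (\<Inter>g\<in>G. {x. blinfun_apply g x \<in> {0}})"
    obtain g :: "'a \<Rightarrow>\<^sub>L real" where "\<And>y. y \<in> Y \<Longrightarrow> blinfun_apply g y = 0"
      "blinfun_apply g x = infdist x Y"
      by (rule hahn_banach_infdist[OF Y(1)]) blast
    then have "infdist x Y = 0" using x by (force simp: G_def)
    then show "x \<in> Y" using Y subspace_0 by (metis in_closed_iff_infdist_zero empty_iff)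
  qed (auto simp: G_def)
  moreover have "closedin weak_topology (\<Inter>g\<in>G. {x. blinfun_apply g x \<in> {0}})"
  proof (intro closedin_INT closedin_weak_vimage)
    have "0 \<in> G" by (simp add: G_def)
    then show "G \<noteq> {}" by blast
  qed auto
  ultimately show ?thesis by argo
qed

section \<open>Weak compactness implies weak sequential compactness\<close>

text \<open>The set \<open>D\<close> consists of the rational linear combinations of the \<open>x n\<close>, so that
  \<open>closure D\<close> is the closed linear span of the sequence.\<close>

lemma separable_closed_subspace:
  fixes x :: "nat \<Rightarrow> 'a::real_normed_vector"
  obtains D where "countable D" "subspace (closure D)" "range x \<subseteq> closure D"
proof
  define lc where "lc qs = sum_list (map (\<lambda>(q, i). of_rat q *\<^sub>R x i) qs)" for qs :: "(rat \<times> nat) list"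
  define D where "D = range lc"
  show "countable D" by (simp add: D_def)
  have add: "a + b \<in> D" if "a \<in> D" "b \<in> D" for a b
  proof -
    obtain qs rs where "a = lc qs" "b = lc rs" using \<open>a \<in> D\<close> \<open>b \<in> D\<close> unfolding D_def by blast
    then have "a + b = lc (qs @ rs)" by (simp add: lc_def)
    then show ?thesis by (simp add: D_def)
  qed
  have "of_rat r *\<^sub>R lc qs = lc (map (\<lambda>(q, i). (r * q, i)) qs)" for r qs
    by (induction qs) (auto simp: lc_def scaleR_add_right of_rat_mult)
  then have scale: "of_rat r *\<^sub>R a \<in> D" if "a \<in> D" for r a
    using that by (auto simp: D_def)
  show "subspace (closure D)"
  proof (rule subspaceI)
    have "0 = lc []" by (simp add: lc_def)
    then show "0 \<in> closure D" unfolding D_def by (metis closure_subset rangeI subsetD)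
  next
    fix a b
    assume "a \<in> closure D" "b \<in> closure D"
    then obtain s t where "\<And>n::nat. s n \<in> D" "s \<longlonglongrightarrow> a" "\<And>n::nat. t n \<in> D" "t \<longlonglongrightarrow> b"
      by (auto simp: closure_sequential)
    then show "a + b \<in> closure D"
      unfolding closure_sequential using add by (intro exI[of _ "\<lambda>n. s n + t n"]) (auto intro: tendsto_add)
  next
    fix c a
    assume "a \<in> closure D"
    then obtain s where s: "\<And>n::nat. s n \<in> D" "s \<longlonglongrightarrow> a" by (auto simp: closure_sequential)
    have "\<exists>r. \<bar>of_rat r - c\<bar> < inverse (real (Suc n))" for n
      using of_rat_dense[of "c - inverse (real (Suc n))" "c + inverse (real (Suc n))"]
      by (auto simp: abs_less_iff algebra_simps)
    then obtain r where r: "\<And>n. \<bar>of_rat (r n) - c\<bar> < inverse (real (Suc n))" by metis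
    have "(\<lambda>n. of_rat (r n) - c) \<longlonglongrightarrow> 0"
      by (rule Lim_null_comparison[OF _ LIMSEQ_inverse_real_of_nat])
        (use r in \<open>auto intro!: always_eventually less_imp_le\<close>)
    then have "(\<lambda>n. of_rat (r n)) \<longlonglongrightarrow> c" by (simp add: LIM_zero_iff)
    then have "(\<lambda>n. of_rat (r n) *\<^sub>R s n) \<longlonglongrightarrow> c *\<^sub>R a" using s(2) by (rule tendsto_scaleR)
    then show "c *\<^sub>R a \<in> closure D"
      unfolding closure_sequential using scale s(1)
      by (intro exI[of _ "\<lambda>n. of_rat (r n) *\<^sub>R s n"]) auto
  qed
  have "x i = lc [(1, i)]" for i by (simp add: lc_def)
  then have "x i \<in> D" for i unfolding D_def by (rule range_eqI)
  then show "range x \<subseteq> closure D" using closure_subset by blast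
qed

text \<open>Take for each \<open>v \<in> D\<close> a functional of norm at most one that norms \<open>v\<close>. If all of these
  vanish at a point \<open>u\<close> of the closure and \<open>v \<in> D\<close> is close to \<open>u\<close>, then \<open>norm v\<close> is the value
  at \<open>v - u\<close> of the functional norming \<open>v\<close>, hence small; so \<open>u = 0\<close>.\<close>

lemma countable_norming_functionals:
  fixes D :: "'a::real_normed_vector set"
  assumes D: "countable D" "subspace (closure D)"
  obtains g :: "nat \<Rightarrow> 'a \<Rightarrow>\<^sub>L real"
  where "inj_on (\<lambda>x n. blinfun_apply (g n) x) (closure D)"
proof -
  define d where "d = from_nat_into D"
  have "D \<noteq> {}" using D(2) subspace_0 by fastforce
  then have D_eq: "D = range d" unfolding d_def using D(1) by (simp add: range_from_nat_into)
  have "\<exists>g :: 'a \<Rightarrow>\<^sub>L real. (\<forall>x. \<bar>blinfun_apply g x\<bar> \<le> norm x) \<and> blinfun_apply g v = norm v" for v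
    by (rule norming_functional[of v]) blast
  then obtain G :: "'a \<Rightarrow> 'a \<Rightarrow>\<^sub>L real"
    where G: "\<And>v x. \<bar>blinfun_apply (G v) x\<bar> \<le> norm x" "\<And>v. blinfun_apply (G v) v = norm v"
    by metis
  show ?thesis
  proof (rule that, rule inj_onI)
    fix a b
    assume ab: "a \<in> closure D" "b \<in> closure D"
      and eq: "(\<lambda>n. blinfun_apply (G (d n)) a) = (\<lambda>n. blinfun_apply (G (d n)) b)"
    have zero: "blinfun_apply (G v) (a - b) = 0" if "v \<in> D" for v
      using that eq by (auto simp: D_eq blinfun.diff_right dest: fun_cong)
    have "norm (a - b) \<le> e" if "0 < e" for e
    proof -
      have "a - b \<in> closure D" using D(2) ab by (rule subspace_diff)
      then obtain v where v: "v \<in> D" "dist v (a - b) < e / 2"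
        using \<open>0 < e\<close> by (metis closure_approachable half_gt_zero)
      have "norm v = blinfun_apply (G v) (v - (a - b))"
        using zero[OF v(1)] G(2)[of v] by (simp add: blinfun.diff_right)
      also have "\<dots> \<le> e / 2" using G(1)[of v "v - (a - b)"] v(2) by (simp add: dist_norm)
      finally show ?thesis
        using v(2) norm_triangle_ineq4[of v "v - (a - b)"] by (simp add: dist_norm)
    qed
    then have "norm (a - b) \<le> 0" by (meson dense_ge)
    then show "a = b" by simp
  qed
qed

text \<open>This is the direction of the Eberlein-Smulian theorem in which compactness implies
  sequential compactness. The closed span of the sequence is weakly closed, so it meets \<open>K\<close> in a
  weakly compact set \<open>L\<close>. Countably many functionals separate the points of \<open>L\<close> and embed it, by
  a homeomorphism because \<open>L\<close> is compact, in the metrizable space \<open>nat \<Rightarrow> real\<close>. There compact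
  sets are sequentially compact.\<close>

theorem weakly_compact_imp_weakly_seq_compact:
  fixes x :: "nat \<Rightarrow> 'a::real_normed_vector"
  assumes K: "compactin weak_topology K" and x: "\<And>n. x n \<in> K"
  obtains r l where "strict_mono r" "l \<in> K" "limitin weak_topology (x \<circ> r) l sequentially"
proof -
  obtain D where D: "countable D" "subspace (closure D)" "range x \<subseteq> closure D"
    by (rule separable_closed_subspace)
  obtain g :: "nat \<Rightarrow> 'a \<Rightarrow>\<^sub>L real" where g: "inj_on (\<lambda>x n. blinfun_apply (g n) x) (closure D)"
    by (rule countable_norming_functionals[OF D(1,2)])
  define E where "E x n = blinfun_apply (g n) x" for x n
  define L where "L = K \<inter> closure D"
  have L: "compactin weak_topology L"
    unfolding L_def Int_commute[of K]
    using closedin_weak_subspace[OF D(2)] K by (intro closed_Int_compactin) auto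
  have xL: "x n \<in> L" for n using x D(3) by (auto simp: L_def)
  have "continuous_map weak_topology (product_topology (\<lambda>_. euclidean) UNIV) E"
    unfolding E_def
    by (intro continuous_map_coordinatewise_then_product continuous_map_weak_topology_blinfun) auto
  then have contE: "continuous_map weak_topology euclidean E"
    by (simp add: euclidean_product_topology)
  have "homeomorphic_map (subtopology weak_topology L) (top_of_set (E ` L)) E"
  proof (rule continuous_imp_homeomorphic_map)
    show "continuous_map (subtopology weak_topology L) (top_of_set (E ` L)) E"
      using contE by (auto simp: continuous_map_in_subtopology continuous_map_from_subtopology)
    show "compact_space (subtopology weak_topology L)"
      using L by (rule compact_space_subtopology)
    show "Hausdorff_space (top_of_set (E ` L))"
      by (simp add: Hausdorff_space_subtopology Hausdorff_space_euclidean)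
    show "inj_on E (topspace (subtopology weak_topology L))"
      using g by (auto simp: L_def E_def[abs_def] intro: inj_on_subset)
  qed auto
  then obtain h where h: "continuous_map (top_of_set (E ` L)) (subtopology weak_topology L) h"
    and hE: "\<And>y. y \<in> L \<Longrightarrow> h (E y) = y"
    by (auto simp: homeomorphic_map_maps homeomorphic_maps_def)
  have "compact (E ` L)"
    using image_compactin[OF L contE] by simp
  then have "seq_compact (E ` L)" by (simp add: compact_eq_seq_compact_metric)
  then obtain r l where r: "strict_mono r" and l: "l \<in> L" "((\<lambda>n. E (x n)) \<circ> r) \<longlonglongrightarrow> E l"
    using xL by (elim seq_compactE[where f = "\<lambda>n. E (x n)"]) auto
  have "limitin (top_of_set (E ` L)) ((\<lambda>n. E (x n)) \<circ> r) (E l) sequentially"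
    using l xL by (simp add: limitin_subtopology)
  from continuous_map_limit[OF h this]
  have "limitin (subtopology weak_topology L) (x \<circ> r) l sequentially"
    using hE l xL by (simp add: o_def)
  then have "limitin weak_topology (x \<circ> r) l sequentially" by (simp add: limitin_subtopology)
  then show ?thesis using that r l(1) by (auto simp: L_def)
qed

text \<open>The Schur property turns the weakly convergent subsequence of the previous theorem into a
  norm convergent one; both limits agree since functionals separate points.\<close>

theorem schur_weakly_compact_imp_compact:
  fixes K :: "'a::banach set"
  assumes schur: "schur_property TYPE('a)" and K: "compactin weak_topology K"
  shows "compact K"
  unfolding compact_def
proof (intro allI impI)
  fix x :: "nat \<Rightarrow> 'a"
  assume x: "\<forall>n. x n \<in> K"
  obtain r l where r: "strict_mono r" and l: "l \<in> K"
    and lim: "limitin weak_topology (x \<circ> r) l sequentially"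
    by (rule weakly_compact_imp_weakly_seq_compact[OF K, of x]) (use x in auto)
  obtain m where m: "(x \<circ> r) \<longlonglongrightarrow> m"
    using schur lim by (auto simp: schur_property_def convergent_def)
  have "blinfun_apply g m = blinfun_apply g l" for g :: "'a \<Rightarrow>\<^sub>L real"
    using LIMSEQ_unique[OF blinfun.tendsto[OF tendsto_const m] limitin_weak_imp_tendsto[OF lim]] .
  then have "m = l" by (rule functionals_separate_points)
  then show "\<exists>l\<in>K. \<exists>r. strict_mono r \<and> (x \<circ> r) \<longlonglongrightarrow> l"
    using r l m by blast
qed

section \<open>The cone over a weakly null sequence\<close>

text \<open>The coefficients of the cone over the infinite convex combinations of \<open>x0\<close> and the points
  \<open>x0 + z k\<close>: the pair \<open>(t, a)\<close> stands for the point \<open>t x0 + (\<Sum>k. a k z k)\<close>, in which \<open>x0\<close> itself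
  has weight \<open>t - (\<Sum>k. a k)\<close>. Bounding all partial sums by \<open>t\<close>, rather than prescribing the
  total sum, makes the set closed in the product topology; with equality, mass could escape to
  infinity.\<close>

definition cone_coeffs :: "(real \<times> (nat \<Rightarrow> real)) set" where
  "cone_coeffs = {(t, a). (\<forall>k. 0 \<le> a k) \<and> (\<forall>n. sum a {..<n} \<le> t)}"

lemma cone_coeffs_nonneg:
  assumes "(t, a) \<in> cone_coeffs"
  shows "0 \<le> a k" "0 \<le> t" "a k \<le> t"
proof -
  have nn: "0 \<le> a k" and s: "sum a {..<n} \<le> t" for k n
    using assms by (auto simp: cone_coeffs_def)
  show "0 \<le> a k" "0 \<le> t" using nn s[of 0] by auto
  have "a k \<le> sum a {..<Suc k}" using nn by (simp add: sum_nonneg)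
  then show "a k \<le> t" using s[of "Suc k"] by simp
qed

lemma cone_coeffs_summable:
  assumes "(t, a) \<in> cone_coeffs"
  shows "summable a" "suminf a \<le> t"
proof -
  show "summable a"
    using assms by (intro summableI_nonneg_bounded[where x = t]) (auto simp: cone_coeffs_def)
  then show "suminf a \<le> t"
    using assms by (intro suminf_le_const) (auto simp: cone_coeffs_def)
qed

lemma norm_weighted_suminf_le:
  fixes c :: "nat \<Rightarrow> 'a::banach"
  assumes a: "summable a" "\<And>k. 0 \<le> a k" and c: "\<And>k. norm (c k) \<le> e"
  shows "summable (\<lambda>k. a k *\<^sub>R c k)" "norm (\<Sum>k. a k *\<^sub>R c k) \<le> suminf a * e"
proof -
  have le: "norm (a k *\<^sub>R c k) \<le> a k * e" for k
    using a(2)[of k] c[of k] by (simp add: mult_left_mono)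
  have sm: "summable (\<lambda>k. a k * e)" using a(1) by (rule summable_mult2)
  show "summable (\<lambda>k. a k *\<^sub>R c k)"
    using le sm by (blast intro: summable_comparison_test')
  show "norm (\<Sum>k. a k *\<^sub>R c k) \<le> suminf a * e"
    using norm_suminf_le[OF le sm] suminf_mult2[OF a(1)] by simp
qed

text \<open>Tychonoff's theorem: the set is closed in a product of compact intervals.\<close>

lemma compact_bounded_cone_coeffs:
  "compact (cone_coeffs \<inter> {p. fst p \<le> T})"
proof -
  have eq: "cone_coeffs = {p. (\<forall>k. 0 \<le> snd p k) \<and> (\<forall>n. sum (snd p) {..<n} \<le> fst p)}"
    by (auto simp: cone_coeffs_def)
  have "closed (cone_coeffs \<inter> {p. fst p \<le> T})"
    unfolding eq Collect_conj_eq[symmetric]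
    by (intro closed_Collect_conj closed_Collect_all closed_Collect_le continuous_on_const
        continuous_on_sum continuous_on_fst continuous_on_id
        continuous_on_product_then_coordinatewise[OF continuous_on_snd[OF continuous_on_id]])
  moreover have "compact ({0..T} \<times> PiE UNIV (\<lambda>_::nat. {0..T}))"
  proof (rule compact_Times)
    have "compactin (product_topology (\<lambda>_. euclidean) UNIV) (PiE UNIV (\<lambda>_::nat. {0..T}))"
      by (simp add: compactin_PiE)
    then show "compact (PiE UNIV (\<lambda>_::nat. {0..T}))"
      by (simp add: euclidean_product_topology)
  qed simp
  moreover have "cone_coeffs \<inter> {p. fst p \<le> T} \<subseteq> {0..T} \<times> PiE UNIV (\<lambda>_. {0..T})"
  proof
    fix p
    assume "p \<in> cone_coeffs \<inter> {p. fst p \<le> T}"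
    then obtain t a where "p = (t, a)" and ta: "(t, a) \<in> cone_coeffs" "t \<le> T" by (cases p) auto
    then show "p \<in> {0..T} \<times> PiE UNIV (\<lambda>_. {0..T})"
      using cone_coeffs_nonneg[OF ta(1)] by (auto simp: PiE_iff intro: order_trans)
  qed
  ultimately show ?thesis using closed_Int_compact by (metis inf.absorb1)
qed

text \<open>The single coefficients are continuous for the product topology, and the series
  converges uniformly, since its tail after \<open>n\<close> is at most \<open>T\<close> times the supremum of
  \<open>\<bar>c k\<bar>\<close> over \<open>k \<ge> n\<close>. This is where \<open>c\<close> has to tend to \<open>0\<close>: summation of the coefficients
  alone is not continuous.\<close>

lemma continuous_on_cone_coeffs_series:
  fixes c :: "nat \<Rightarrow> real"
  assumes c: "c \<longlonglongrightarrow> 0"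
  shows "continuous_on (cone_coeffs \<inter> {p. fst p \<le> T}) (\<lambda>p. \<Sum>k. snd p k * c k)"
proof (rule uniform_limit_theorem)
  let ?S = "cone_coeffs \<inter> {p. fst p \<le> T}"
  show "\<forall>\<^sub>F n in sequentially. continuous_on ?S (\<lambda>p. \<Sum>k<n. snd p k * c k)"
    by (intro always_eventually allI continuous_on_sum continuous_on_mult continuous_on_const
        continuous_on_product_then_coordinatewise[OF continuous_on_snd[OF continuous_on_id]])
  show "uniform_limit ?S (\<lambda>n p. \<Sum>k<n. snd p k * c k) (\<lambda>p. \<Sum>k. snd p k * c k) sequentially"
  proof (rule uniform_limitI)
    fix e :: real
    assume e: "0 < e"
    \<comment> \<open>The tail is at most \<open>T * d\<close>; the denominator exceeds \<open>T\<close> and is never \<open>0\<close>.\<close>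
    define d where "d = e / (\<bar>T\<bar> + 1)"
    have "0 < d" using e by (simp add: d_def)
    then obtain N where N: "\<And>k. N \<le> k \<Longrightarrow> \<bar>c k\<bar> < d"
      using LIMSEQ_D[OF c] by force
    obtain M where M: "\<And>k. \<bar>c k\<bar> \<le> M"
      using convergent_imp_Bseq[of c] c by (auto simp: convergent_def Bseq_def)
    have "dist (\<Sum>k<n. snd p k * c k) (\<Sum>k. snd p k * c k) < e" if n: "N \<le> n" and p: "p \<in> ?S" for n p
    proof -
      obtain t a where ta: "p = (t, a)" "(t, a) \<in> cone_coeffs" "t \<le> T" using p by (cases p) auto
      note a = cone_coeffs_summable[OF ta(2)] cone_coeffs_nonneg[OF ta(2)]
      have "summable (\<lambda>k. a k * c k)"
        using norm_weighted_suminf_le(1)[of a c M] a M by simp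
      then have "(\<Sum>k. a k * c k) = (\<Sum>k. a (k + n) * c (k + n)) + (\<Sum>k<n. a k * c k)"
        by (rule suminf_split_initial_segment)
      moreover have "\<bar>\<Sum>k. a (k + n) * c (k + n)\<bar> \<le> (\<Sum>k. a (k + n)) * d"
        using norm_weighted_suminf_le(2)[of "\<lambda>k. a (k + n)" "\<lambda>k. c (k + n)" d] a n N
        by (auto simp: summable_ignore_initial_segment less_imp_le)
      moreover have "(\<Sum>k. a (k + n)) \<le> T"
        using suminf_minus_initial_segment[OF a(1), of n] a ta(3) sum_nonneg[of "{..<n}" a] by simp
      then have "(\<Sum>k. a (k + n)) * d \<le> T * d" using \<open>0 < d\<close> by (simp add: mult_right_mono)
      moreover have "T * d < e"
        using e by (auto simp: d_def field_simps abs_if split: if_splits)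
      ultimately show ?thesis by (simp add: ta(1) dist_real_def)
    qed
    then show "\<forall>\<^sub>F n in sequentially. \<forall>p\<in>?S. dist (\<Sum>k<n. snd p k * c k) (\<Sum>k. snd p k * c k) < e"
      unfolding eventually_sequentially by blast
  qed
qed simp

definition cone_comb :: "'a::banach \<Rightarrow> (nat \<Rightarrow> 'a) \<Rightarrow> real \<times> (nat \<Rightarrow> real) \<Rightarrow> 'a" where
  "cone_comb x0 z p = fst p *\<^sub>R x0 + (\<Sum>k. snd p k *\<^sub>R z k)"

lemma convex_cone_cone_comb:
  fixes z :: "nat \<Rightarrow> 'a::banach"
  assumes z: "\<And>k. norm (z k) \<le> 1"
  shows "convex_cone (cone_comb x0 z ` cone_coeffs)"
  unfolding convex_cone_iff
proof (intro conjI ballI allI impI)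
  have "(0, \<lambda>_. 0) \<in> cone_coeffs" by (simp add: cone_coeffs_def)
  then show "0 \<in> cone_comb x0 z ` cone_coeffs"
    by (rule rev_image_eqI) (simp add: cone_comb_def)
next
  fix x y
  assume "x \<in> cone_comb x0 z ` cone_coeffs" "y \<in> cone_comb x0 z ` cone_coeffs"
  then obtain t a s b where ta: "(t, a) \<in> cone_coeffs" "x = cone_comb x0 z (t, a)"
    and sb: "(s, b) \<in> cone_coeffs" "y = cone_comb x0 z (s, b)" by auto
  have "summable (\<lambda>k. a k *\<^sub>R z k)" "summable (\<lambda>k. b k *\<^sub>R z k)"
    using cone_coeffs_summable cone_coeffs_nonneg ta(1) sb(1) z
    by (blast intro: norm_weighted_suminf_le(1))+
  then have "x + y = cone_comb x0 z (t + s, \<lambda>k. a k + b k)"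
    using ta(2) sb(2) by (simp add: cone_comb_def scaleR_add_left suminf_add[symmetric])
  moreover have "(t + s, \<lambda>k. a k + b k) \<in> cone_coeffs"
    using ta(1) sb(1) by (auto simp: cone_coeffs_def sum.distrib add_mono)
  ultimately show "x + y \<in> cone_comb x0 z ` cone_coeffs" by blast
next
  fix x and c :: real
  assume "x \<in> cone_comb x0 z ` cone_coeffs" and c: "0 \<le> c"
  then obtain t a where ta: "(t, a) \<in> cone_coeffs" "x = cone_comb x0 z (t, a)" by auto
  have "summable (\<lambda>k. a k *\<^sub>R z k)"
    using cone_coeffs_summable cone_coeffs_nonneg ta(1) z
    by (blast intro: norm_weighted_suminf_le(1))
  then have "c *\<^sub>R x = cone_comb x0 z (c * t, \<lambda>k. c * a k)"
    using ta(2) suminf_scaleR_right[of "\<lambda>k. a k *\<^sub>R z k" c] by (simp add: cone_comb_def scaleR_add_right)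
  moreover have "(c * t, \<lambda>k. c * a k) \<in> cone_coeffs"
    using ta(1) c by (auto simp: cone_coeffs_def mult_left_mono simp flip: sum_distrib_left)
  ultimately show "c *\<^sub>R x \<in> cone_comb x0 z ` cone_coeffs" by blast
qed

lemma blinfun_apply_cone_comb:
  fixes g :: "'a::banach \<Rightarrow>\<^sub>L real"
  assumes z: "\<And>k. norm (z k) \<le> 1" and p: "p \<in> cone_coeffs"
  shows "blinfun_apply g (cone_comb x0 z p) =
    fst p * blinfun_apply g x0 + (\<Sum>k. snd p k * blinfun_apply g (z k))"
proof -
  obtain t a where ta: "p = (t, a)" "(t, a) \<in> cone_coeffs" using p by (cases p) auto
  have "summable (\<lambda>k. a k *\<^sub>R z k)"
    using cone_coeffs_summable cone_coeffs_nonneg ta(2) z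
    by (blast intro: norm_weighted_suminf_le(1))
  then show ?thesis
    using bounded_linear.suminf[OF blinfun.bounded_linear_right, of "\<lambda>k. a k *\<^sub>R z k" g]
    by (simp add: ta(1) cone_comb_def blinfun.add_right blinfun.scaleR_right)
qed

text \<open>The points with bounded parameter \<open>t\<close> form a continuous image of a compact set. Composed with a
  functional \<open>g\<close>, the parametrization is a series with weights \<open>g (z k)\<close>, which tend to \<open>0\<close>.\<close>

lemma compactin_weak_cone_comb:
  fixes z :: "nat \<Rightarrow> 'a::banach"
  assumes z: "\<And>k. norm (z k) \<le> 1"
    and null: "\<And>g :: 'a \<Rightarrow>\<^sub>L real. (\<lambda>k. blinfun_apply g (z k)) \<longlonglongrightarrow> 0"
  shows "compactin weak_topology (cone_comb x0 z ` (cone_coeffs \<inter> {p. fst p \<le> T}))"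
proof (rule image_compactin)
  let ?S = "cone_coeffs \<inter> {p. fst p \<le> T}"
  show "compactin (top_of_set ?S) ?S"
    using compact_bounded_cone_coeffs[of T] by simp
  show "continuous_map (top_of_set ?S) weak_topology (cone_comb x0 z)"
  proof (rule continuous_map_into_weak_topology)
    fix g :: "'a \<Rightarrow>\<^sub>L real"
    have "continuous_on ?S (\<lambda>p. fst p * blinfun_apply g x0 + (\<Sum>k. snd p k * blinfun_apply g (z k)))"
      by (intro continuous_on_add continuous_on_mult continuous_on_fst continuous_on_id
          continuous_on_const continuous_on_cone_coeffs_series null)
    then have "continuous_on ?S (\<lambda>p. blinfun_apply g (cone_comb x0 z p))"
      by (rule continuous_on_eq) (use blinfun_apply_cone_comb[OF z, of _ g x0] in auto)
    then show "continuous_map (top_of_set ?S) euclidean (\<lambda>p. blinfun_apply g (cone_comb x0 z p))"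
      by simp
  qed
qed

text \<open>Let \<open>x0 = z 0\<close> and let \<open>f\<close> be a functional of norm at most one with \<open>f x0 = 1\<close>. Far out in the
  sequence \<open>\<bar>f (z k)\<bar> \<le> 1 / 2\<close>, so after a shift the point \<open>u\<close> of the cone with
  coefficients \<open>(t, a)\<close> satisfies \<open>t / 2 \<le> f u\<close> and \<open>norm u \<le> 2 t\<close>. Hence \<open>f\<close> is strictly
  positive with a bounded base, and the part of the cone in the unit ball is contained in the weakly
  compact set of the points with \<open>t \<le> 2\<close>. It is not norm compact: a norm limit of a
  subsequence of the \<open>z k\<close> would be \<open>0\<close> as well as of norm one.\<close>

theorem cone_from_weakly_null_sequence:
  fixes z :: "nat \<Rightarrow> 'a::banach"
  assumes z: "\<And>k. norm (z k) = 1"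
    and null: "\<And>g :: 'a \<Rightarrow>\<^sub>L real. (\<lambda>k. blinfun_apply g (z k)) \<longlonglongrightarrow> 0"
  obtains P :: "'a set" where "reflexive_cone P" "has_bounded_base P" "\<not> strongly_reflexive_cone P"
proof -
  define x0 where "x0 = z 0"
  obtain f :: "'a \<Rightarrow>\<^sub>L real"
    where f: "\<And>x. \<bar>blinfun_apply f x\<bar> \<le> norm x" "blinfun_apply f x0 = norm x0"
    by (rule norming_functional[of x0]) blast
  have x0: "norm x0 = 1" using z by (simp add: x0_def)
  have "\<exists>N. \<forall>k\<ge>N. norm (blinfun_apply f (z k) - 0) < 1 / 2"
    by (rule LIMSEQ_D[OF null]) simp
  then obtain N where N: "\<forall>k\<ge>N. norm (blinfun_apply f (z k) - 0) < 1 / 2" ..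
  define y where "y k = z (k + N)" for k
  have y: "norm (y k) = 1" "\<bar>blinfun_apply f (y k)\<bar> \<le> 1 / 2" for k
    using z N[rule_format, of "k + N"] by (simp_all add: y_def)
  have y1: "norm (y k) \<le> 1" for k using y(1) by simp
  have y_null: "(\<lambda>k. blinfun_apply g (y k)) \<longlonglongrightarrow> 0" for g :: "'a \<Rightarrow>\<^sub>L real"
    unfolding y_def using null by (rule LIMSEQ_ignore_initial_segment)
  define P where "P = cone_comb x0 y ` cone_coeffs"
  have f_ge: "t / 2 \<le> blinfun_apply f (cone_comb x0 y (t, a))"
    and norm_le: "norm (cone_comb x0 y (t, a)) \<le> 2 * t"
    if ta: "(t, a) \<in> cone_coeffs" for t a
  proof -
    note a = cone_coeffs_summable[OF ta] cone_coeffs_nonneg[OF ta]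
    have "\<bar>\<Sum>k. a k * blinfun_apply f (y k)\<bar> \<le> suminf a * (1 / 2)"
      using norm_weighted_suminf_le(2)[of a "\<lambda>k. blinfun_apply f (y k)" "1 / 2"] a y(2) by simp
    then show "t / 2 \<le> blinfun_apply f (cone_comb x0 y (t, a))"
      using blinfun_apply_cone_comb[OF y1 ta, of f x0] a(2) f(2) x0 by simp
    have "norm (\<Sum>k. a k *\<^sub>R y k) \<le> suminf a * 1"
      using a y1 by (intro norm_weighted_suminf_le(2))
    moreover have "norm (t *\<^sub>R x0) = t" using x0 a by simp
    ultimately show "norm (cone_comb x0 y (t, a)) \<le> 2 * t"
      using a(2) norm_triangle_ineq[of "t *\<^sub>R x0" "\<Sum>k. a k *\<^sub>R y k"] by (simp add: cone_comb_def)
  qed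
  have cone: "convex_cone P" unfolding P_def using y1 by (rule convex_cone_cone_comb)
  show ?thesis
  proof (rule that)
    \<comment> \<open>On the unit ball \<open>f \<le> 1\<close>, and \<open>t / 2 \<le> f\<close> on the cone.\<close>
    have "P \<inter> cball 0 1 = cball 0 1 \<inter> cone_comb x0 y ` (cone_coeffs \<inter> {p. fst p \<le> 2})"
    proof -
      have "t \<le> 2" if "(t, a) \<in> cone_coeffs" "norm (cone_comb x0 y (t, a)) \<le> 1" for t a
        using f_ge[OF that(1)] f(1)[of "cone_comb x0 y (t, a)"] that(2) by simp
      then show ?thesis by (auto simp: P_def)
    qed
    then have "compactin weak_topology (P \<inter> cball 0 1)"
      using closed_Int_compactin[OF closedin_weak_cball compactin_weak_cone_comb[OF y1 y_null]]
      by simp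
    then show "reflexive_cone P" using cone by (simp add: reflexive_cone_def)
  next
    have "strictly_positive_on f P"
      unfolding strictly_positive_on_def
    proof
      fix x
      assume "x \<in> P - {0}"
      then obtain t a where ta: "(t, a) \<in> cone_coeffs" "x = cone_comb x0 y (t, a)" "x \<noteq> 0"
        by (auto simp: P_def)
      then have "0 < norm x" by simp
      then have "0 < t" using norm_le[OF ta(1)] unfolding ta(2) by linarith
      then show "0 < blinfun_apply f x" using f_ge[OF ta(1)] ta(2) by simp
    qed
    moreover have "bounded (cone_base f P)"
    proof (rule boundedI)
      fix x
      assume "x \<in> cone_base f P"
      then obtain t a where ta: "(t, a) \<in> cone_coeffs" "x = cone_comb x0 y (t, a)" "blinfun_apply f x = 1"
        by (auto simp: P_def cone_base_def)
      show "norm x \<le> 4" using f_ge[OF ta(1)] norm_le[OF ta(1)] ta(2,3) by simp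
    qed
    ultimately show "has_bounded_base P" by (auto simp: has_bounded_base_def)
  next
    show "\<not> strongly_reflexive_cone P"
    proof
      assume "strongly_reflexive_cone P"
      then have cpt: "compact (P \<inter> cball 0 1)" by (simp add: strongly_reflexive_cone_def)
      have mem: "(1 / 2) *\<^sub>R (x0 + y k) \<in> P \<inter> cball 0 1" for k
      proof
        \<comment> \<open>Scaling by \<open>1 / 2\<close> brings \<open>x0 + y k\<close>, of norm at most two, into the unit ball.\<close>
        define a :: "nat \<Rightarrow> real" where "a j = (if j = k then 1 / 2 else 0)" for j
        have "sum a {..<n} \<le> 1 / 2" for n by (simp add: a_def)
        then have "(1 / 2, a) \<in> cone_coeffs" by (simp add: cone_coeffs_def) (simp add: a_def)
        moreover have "(\<Sum>j. a j *\<^sub>R y j) = (1 / 2) *\<^sub>R y k"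
          using suminf_finite[of "{k}" "\<lambda>j. a j *\<^sub>R y j"] by (simp add: a_def)
        then have "cone_comb x0 y (1 / 2, a) = (1 / 2) *\<^sub>R (x0 + y k)"
          by (simp add: cone_comb_def scaleR_add_right)
        ultimately show "(1 / 2) *\<^sub>R (x0 + y k) \<in> P" unfolding P_def by (metis imageI)
        show "(1 / 2) *\<^sub>R (x0 + y k) \<in> cball 0 1"
          using norm_triangle_ineq[of x0 "y k"] y(1)[of k] x0 by simp
      qed
      obtain m and r :: "nat \<Rightarrow> nat" where r: "strict_mono r"
        and "((\<lambda>k. (1 / 2) *\<^sub>R (x0 + y k)) \<circ> r) \<longlonglongrightarrow> m"
        by (rule seq_compactE[OF compact_imp_seq_compact[OF cpt], of "\<lambda>k. (1 / 2) *\<^sub>R (x0 + y k)"])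
          (use mem in blast)+
      then have m: "(\<lambda>k. (1 / 2) *\<^sub>R (x0 + y (r k))) \<longlonglongrightarrow> m" by (simp add: o_def)
      define w where "w = 2 *\<^sub>R m - x0"
      have "(\<lambda>k. 2 *\<^sub>R ((1 / 2) *\<^sub>R (x0 + y (r k))) - x0) \<longlonglongrightarrow> w"
        unfolding w_def by (intro tendsto_intros m)
      then have w: "(\<lambda>k. y (r k)) \<longlonglongrightarrow> w" by simp
      have "blinfun_apply g w = 0" for g :: "'a \<Rightarrow>\<^sub>L real"
      proof (rule LIMSEQ_unique)
        show "(\<lambda>k. blinfun_apply g (y (r k))) \<longlonglongrightarrow> blinfun_apply g w"
          using w by (intro tendsto_intros)
        show "(\<lambda>k. blinfun_apply g (y (r k))) \<longlonglongrightarrow> 0"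
          using LIMSEQ_subseq_LIMSEQ[OF y_null[of g] r] by (simp add: o_def)
      qed
      then have "w = 0" using functionals_separate_points[of w 0] by simp
      moreover have "norm w = 1"
        using tendsto_norm[OF w] y(1) by (simp add: LIMSEQ_const_iff)
      ultimately show False by simp
    qed
  qed
qed

section \<open>The Schur property and reflexive cones\<close>

text \<open>A subsequence of the differences \<open>x k - l\<close> stays away from \<open>0\<close> in norm. Dividing by norms
  that are bounded below preserves weak convergence to \<open>0\<close>.\<close>

lemma not_schur_imp_weakly_null_sequence:
  assumes "\<not> schur_property TYPE('a::banach)"
  obtains z :: "nat \<Rightarrow> 'a::banach"
  where "\<And>k. norm (z k) = 1"
    "\<And>g :: 'a::banach \<Rightarrow>\<^sub>L real. (\<lambda>k. blinfun_apply g (z k)) \<longlonglongrightarrow> 0"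
proof -
  obtain x :: "nat \<Rightarrow> 'a" and l where lim: "limitin weak_topology x l sequentially"
    and "\<not> convergent x" using assms by (auto simp: schur_property_def)
  then have "\<not> x \<longlonglongrightarrow> l" by (auto simp: convergent_def)
  then obtain e where e: "0 < e" "\<And>n. \<exists>k\<ge>n. e \<le> norm (x k - l)"
    by (auto simp: LIMSEQ_iff not_less)
  then have "infinite {k. e \<le> norm (x k - l)}"
    by (auto simp: infinite_nat_iff_unbounded_le)
  then obtain r :: "nat \<Rightarrow> nat" where r: "strict_mono r" "\<And>k. e \<le> norm (x (r k) - l)"
    by (auto dest: infinite_enumerate)
  define y where "y k = x (r k) - l" for k
  have y: "e \<le> norm (y k)" for k using r(2) by (simp add: y_def)
  have pos: "0 < norm (y k)" for k using y[of k] e(1) by (rule less_le_trans[rotated])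
  show ?thesis
  proof
    show "norm (y k /\<^sub>R norm (y k)) = 1" for k using pos[of k] by simp
    fix g :: "'a \<Rightarrow>\<^sub>L real"
    have "(\<lambda>k. blinfun_apply g (x (r k))) \<longlonglongrightarrow> blinfun_apply g l"
      using LIMSEQ_subseq_LIMSEQ[OF limitin_weak_imp_tendsto[OF lim] r(1)] by (simp add: o_def)
    then have "(\<lambda>k. blinfun_apply g (y k)) \<longlonglongrightarrow> 0"
      unfolding y_def blinfun.diff_right by (simp add: LIM_zero_iff)
    then have lim0: "(\<lambda>k. \<bar>blinfun_apply g (y k)\<bar> / e) \<longlonglongrightarrow> 0"
      by (auto intro: tendsto_divide_zero tendsto_rabs_zero)
    have "norm (blinfun_apply g (y k /\<^sub>R norm (y k))) \<le> \<bar>blinfun_apply g (y k)\<bar> / e" for k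
    proof -
      have "\<bar>blinfun_apply g (y k)\<bar> / norm (y k) \<le> \<bar>blinfun_apply g (y k)\<bar> / e"
        using y[of k] e(1) pos[of k] by (intro divide_left_mono mult_pos_pos) auto
      then show ?thesis by (simp add: blinfun.scaleR_right abs_mult divide_inverse mult.commute)
    qed
    then show "(\<lambda>k. blinfun_apply g (y k /\<^sub>R norm (y k))) \<longlonglongrightarrow> 0"
      by (intro Lim_null_comparison[OF _ lim0]) simp
  qed
qed

theorem theorem5p6:
  shows "schur_property TYPE('a::banach) \<longleftrightarrow>
    (\<forall>P :: 'a set. reflexive_cone P \<and> has_bounded_base P \<longrightarrow> strongly_reflexive_cone P)"
proof
  assume "schur_property TYPE('a)"
  then show "\<forall>P :: 'a set. reflexive_cone P \<and> has_bounded_base P \<longrightarrow> strongly_reflexive_cone P"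
    using schur_weakly_compact_imp_compact
    by (auto simp: reflexive_cone_def strongly_reflexive_cone_def)
next
  assume cones: "\<forall>P :: 'a set. reflexive_cone P \<and> has_bounded_base P \<longrightarrow> strongly_reflexive_cone P"
  show "schur_property TYPE('a)"
  proof (rule ccontr)
    assume "\<not> schur_property TYPE('a)"
    then obtain z :: "nat \<Rightarrow> 'a" where z: "\<And>k. norm (z k) = 1"
      "\<And>g :: 'a \<Rightarrow>\<^sub>L real. (\<lambda>k. blinfun_apply g (z k)) \<longlonglongrightarrow> 0"
      by (rule not_schur_imp_weakly_null_sequence) blast
    show False
      by (rule cone_from_weakly_null_sequence[OF z]) (use cones in auto)
  qed
qed

end
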